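(* Let $\mathfrak{h}\subset\mathfrak{so}(n)$ be a Cartan subalgebra which has a basis that is a subset of $\{E_{ij}\mid 1\le i<j\le n\}$. Then every $M\in\mathfrak{h}$ is an equilibrium point of the generalized rigid body equations $\dot M=[M,\Omega]$ on $\mathfrak{so}(n)$.
   Context: $\mathfrak{so}(n)$ is the Lie algebra of real antisymmetric $n\times n$ matrices. Let $J=\operatorname{diag}(\lambda_1,\dots,\lambda_n)$ be a constant real diagonal matrix with $\lambda_i+\lambda_j>0$ for all $i\neq j$ and with all $\lambda_i$ distinct. The generalized rigid body equations are $\dot M=[M,\Omega]$, where $\Omega\in\mathfrak{so}(n)$ and $M=\Omega J+J\Omega\in\mathfrak{so}(n)$. Since $m_{ij}=(\lambda_i+\lambda_j)\omega_{ij}$, the matrices $M$ and $\Omega$ determine each other, so this is a differential equation for $M$. An equilibrium is an $M$ with $[M,\Omega]=0$. For $i<j$, $E_{ij}$ denotes the antisymmetric matrix with entry $1$ in position $(i,j)$, $-1$ in position $(j,i)$, and $0$ elsewhere; the $E_{ij}$, $i<j$, form a basis of $\mathfrak{so}(n)$. *)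

theory Defs
  imports "HOL-Analysis.Analysis"
begin

(* Matrices are indexed by a finite linearly ordered type 'n, playing the role of
   {1..n} with n = CARD('n); the order is used only to express i < j. *)

definition so :: "(real^'n^'n) set" where
  "so = {A. transpose A = - A}"

definition lie_bracket :: "real^'n^'n \<Rightarrow> real^'n^'n \<Rightarrow> real^'n^'n" where
  "lie_bracket A B = A ** B - B ** A"

definition lie_subalgebra :: "(real^'n^'n) set \<Rightarrow> (real^'n^'n) set \<Rightarrow> bool" where
  "lie_subalgebra h g \<longleftrightarrow>
     h \<subseteq> g \<and> subspace h \<and> (\<forall>A\<in>h. \<forall>B\<in>h. lie_bracket A B \<in> h)"

fun lower_central_series :: "(real^'n^'n) set \<Rightarrow> nat \<Rightarrow> (real^'n^'n) set" where
  "lower_central_series h 0 = h"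
| "lower_central_series h (Suc k) =
     span {lie_bracket A B | A B. A \<in> h \<and> B \<in> lower_central_series h k}"

definition lie_nilpotent :: "(real^'n^'n) set \<Rightarrow> bool" where
  "lie_nilpotent h \<longleftrightarrow> (\<exists>k. lower_central_series h k = {0})"

definition normalizer :: "(real^'n^'n) set \<Rightarrow> (real^'n^'n) set \<Rightarrow> (real^'n^'n) set" where
  "normalizer h g = {A \<in> g. \<forall>B\<in>h. lie_bracket A B \<in> h}"

(* The general definition: a nilpotent, self-normalizing subalgebra. For so(n) these are
   the maximal abelian subalgebras, but commutativity is not built in here. *)
definition cartan_subalgebra :: "(real^'n^'n) set \<Rightarrow> (real^'n^'n) set \<Rightarrow> bool" where
  "cartan_subalgebra h g \<longleftrightarrow>
     lie_subalgebra h g \<and> lie_nilpotent h \<and> normalizer h g = h"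

definition E :: "'n \<Rightarrow> 'n \<Rightarrow> real^'n^'n" where
  "E i j = (\<chi> k l. if k = i \<and> l = j then 1 else if k = j \<and> l = i then - 1 else 0)"

definition diag_matrix :: "('n \<Rightarrow> real) \<Rightarrow> real^'n^'n" where
  "diag_matrix d = (\<chi> i j. if i = j then d i else 0)"

definition angular_velocity :: "real^'n^'n \<Rightarrow> real^'n^'n \<Rightarrow> real^'n^'n" where
  "angular_velocity J M = (THE \<Omega>. \<Omega> \<in> so \<and> M = \<Omega> ** J + J ** \<Omega>)"

definition rigid_body_field :: "real^'n^'n \<Rightarrow> real^'n^'n \<Rightarrow> real^'n^'n" where
  "rigid_body_field J M = lie_bracket M (angular_velocity J M)"

definition rigid_body_equilibrium :: "real^'n^'n \<Rightarrow> real^'n^'n \<Rightarrow> bool" where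
  "rigid_body_equilibrium J M \<longleftrightarrow> M \<in> so \<and> rigid_body_field J M = 0"

lemma momentum_entry:
  fixes \<Omega> :: "real^'n^'n"
  shows "(\<Omega> ** diag_matrix d + diag_matrix d ** \<Omega>) $ i $ j = (d i + d j) * \<Omega> $ i $ j"
  by (simp add: matrix_matrix_mult_def diag_matrix_def if_distrib [of "\<lambda>x. _ * x"]
      if_distrib [of "\<lambda>x. x * _"] sum.delta sum.delta' algebra_simps cong: if_cong)

lemma so_entry: "A \<in> so \<longleftrightarrow> (\<forall>i j. A $ j $ i = - A $ i $ j)"
  by (simp add: so_def transpose_def vec_eq_iff)

(* The description in angular_velocity is proper under the standing assumption on J. *)
lemma angular_velocity_unique:
  fixes M :: "real^'n^'n"
  assumes "\<And>i j. i \<noteq> j \<Longrightarrow> d i + d j > 0" and M: "M \<in> so"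
  shows "\<exists>!\<Omega>. \<Omega> \<in> so \<and> M = \<Omega> ** diag_matrix d + diag_matrix d ** \<Omega>"
proof (rule ex1I)
  have ne: "d i + d j \<noteq> 0" if "i \<noteq> j" for i j
    using assms(1)[OF that] by simp
  have diag: "A $ i $ i = 0" if "A \<in> so" for A :: "real^'n^'n" and i
  proof -
    have "A $ i $ i = - A $ i $ i"
      using that unfolding so_entry by blast
    then show ?thesis by simp
  qed
  let ?W = "(\<chi> i j. M $ i $ j / (d i + d j)) :: real^'n^'n"
  have "M $ i $ j = (d i + d j) * ?W $ i $ j" for i j
    by (cases "i = j") (simp_all add: diag[OF M] ne)
  moreover have "?W \<in> so"
    unfolding so_entry
  proof (intro allI)
    fix i j
    have "M $ j $ i = - M $ i $ j"
      using M unfolding so_entry by blast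
    then show "?W $ j $ i = - ?W $ i $ j"
      by (simp add: add.commute)
  qed
  ultimately show "?W \<in> so \<and> M = ?W ** diag_matrix d + diag_matrix d ** ?W"
    unfolding vec_eq_iff[of M] vec_eq_iff[of "M $ _"] momentum_entry by blast
  fix \<Omega> assume "\<Omega> \<in> so \<and> M = \<Omega> ** diag_matrix d + diag_matrix d ** \<Omega>"
  then have "\<Omega> \<in> so" and "M $ i $ j = (d i + d j) * \<Omega> $ i $ j" for i j
    using momentum_entry by metis+
  then have "\<Omega> $ i $ j = ?W $ i $ j" for i j
    by (cases "i = j") (simp_all add: diag ne)
  then show "\<Omega> = ?W" by (simp add: vec_eq_iff)
qed

end

theory Submission imports Defs begin

text \<open>
  For distinct \<open>i, j, k\<close> the matrices \<open>E i j\<close>, \<open>E j k\<close>, \<open>E i k\<close> span a copy of \<open>so(3)\<close>, which is not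
  nilpotent: bracketing with \<open>E i j\<close> rotates the plane of \<open>E j k\<close> and \<open>E i k\<close>, so these two never
  leave the lower central series (\<open>not_nilpotent_if_adjacent\<close>). A nilpotent subalgebra spanned by
  matrices \<open>E i j\<close> therefore involves only pairwise disjoint index pairs: the pairs form a matching
  on the index set. Every \<open>M\<close> in it has at most one nonzero entry in each row
  (\<open>unique_nonzero_neighbour\<close>), which is to say that it is block diagonal with blocks of size at
  most two, up to a reordering of the basis.

  The inertia operator divides the entry \<open>(i, j)\<close> by \<open>d i + d j\<close>. Hence the \<open>(i, k)\<close> entry of
  \<open>[M, \<Omega>]\<close> is a sum over \<open>j\<close> of terms
  \<open>M\<^sub>i\<^sub>j M\<^sub>j\<^sub>k (1 / (d j + d k) - 1 / (d i + d j))\<close>.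
  If the product \<open>M\<^sub>i\<^sub>j M\<^sub>j\<^sub>k\<close> is nonzero then the matching forces \<open>i = k\<close>, and in
  that case the two fractions agree. So every term is zero and \<open>M\<close> is an equilibrium.
\<close>

lemma E_mult_entry:
  assumes "i \<noteq> j"
  shows "(E i j ** A) $ k $ l = (if k = i then A $ j $ l else if k = j then - A $ i $ l else 0)"
  using assms
  by (simp add: matrix_matrix_mult_def E_def if_distrib [of "\<lambda>x. x * _"] cong: if_cong)

lemma E_swap: "E j i = - E i j" if "i \<noteq> j"
  using that by (auto simp: E_def vec_eq_iff)

lemma lie_bracket_E:
  assumes "i \<noteq> j" "j \<noteq> k" "i \<noteq> k"
  shows "lie_bracket (E i j) (E j k) = E i k"
  unfolding vec_eq_iff lie_bracket_def vector_minus_component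
    E_mult_entry[OF assms(1)] E_mult_entry[OF assms(2)]
  using assms by (simp add: E_def)

text \<open>
  Tracking \<open>E i k\<close> and \<open>E j k\<close> together is what makes the induction close: the bracket with
  \<open>E i j\<close> produces either one from the other.
\<close>

lemma not_nilpotent_if_adjacent:
  fixes i j k :: "'n::finite"
  assumes sub: "lie_subalgebra h g" and "E i j \<in> h" "E j k \<in> h"
    and dist: "i \<noteq> j" "j \<noteq> k" "i \<noteq> k"
  shows "\<not> lie_nilpotent h"
proof
  have ji: "E j i \<in> h"
    using assms E_swap[OF dist(1)] by (simp add: lie_subalgebra_def subspace_neg)
  have rotate: "lie_bracket (E i j) (E j k) = E i k" "lie_bracket (E j i) (E i k) = E j k"
    using dist by (simp_all add: lie_bracket_E)
  have persist: "E i k \<in> lower_central_series h m \<and> E j k \<in> lower_central_series h m" for m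
  proof (induction m)
    case 0
    then show ?case
      using assms rotate(1) by (metis lie_subalgebra_def lower_central_series.simps(1))
  next
    case (Suc m)
    have step: "lie_bracket A B \<in> lower_central_series h (Suc m)"
      if "A \<in> h" "B \<in> lower_central_series h m" for A B
      using that by (auto intro: span_base)
    show ?case
      using step[OF assms(2)] step[OF ji] Suc.IH rotate by metis
  qed
  assume "lie_nilpotent h"
  then have "E i k = 0"
    using persist unfolding lie_nilpotent_def by (metis singletonD)
  then have "E i k $ i $ k = 0"
    by simp
  then show False
    by (simp add: E_def)
qed

lemma E_in_span_if_entry_nonzero:
  fixes M :: "real^'n::{finite,linorder}^'n::{finite,linorder}"
  assumes B: "B \<subseteq> {E i j | i j. i < j}" and M: "M \<in> span B" and nz: "M $ a $ b \<noteq> 0"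
  shows "a \<noteq> b" "E a b \<in> span B"
proof -
  obtain A where A: "A \<in> B" "A $ a $ b \<noteq> 0"
  proof (rule ccontr)
    assume "\<not> thesis"
    with that have "B \<subseteq> {A. A $ a $ b = 0}"
      by blast
    moreover have "subspace {A :: real^'n::{finite,linorder}^'n::{finite,linorder}. A $ a $ b = 0}"
      by (simp add: subspace_def)
    ultimately have "span B \<subseteq> {A. A $ a $ b = 0}"
      by (rule span_minimal)
    with M nz show False
      by blast
  qed
  then obtain i j where ij: "i < j" "A = E i j"
    using B by blast
  with A(2) have cases: "(a = i \<and> b = j) \<or> (a = j \<and> b = i)"
    by (auto simp: E_def split: if_splits)
  show "a \<noteq> b"
    using cases ij(1) by auto
  have "E i j \<in> span B"
    using A(1) ij(2) by (simp add: span_base)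
  then show "E a b \<in> span B"
    using cases E_swap[of i j] ij(1) by (auto simp: span_neg)
qed

lemma unique_nonzero_neighbour:
  fixes M :: "real^'n::{finite,linorder}^'n::{finite,linorder}"
  assumes h: "lie_subalgebra h g" "lie_nilpotent h"
    and B: "B \<subseteq> {E i j | i j. i < j}" "span B = h"
    and M: "M \<in> h" and nz: "M $ i $ j \<noteq> 0" "M $ j $ k \<noteq> 0"
  shows "i = k"
proof -
  note E_in_h = E_in_span_if_entry_nonzero[OF B(1), unfolded B(2), OF M]
  show ?thesis
    using not_nilpotent_if_adjacent[OF h(1) E_in_h(2)[OF nz(1)] E_in_h(2)[OF nz(2)]]
      E_in_h(1)[OF nz(1)] E_in_h(1)[OF nz(2)] h(2) by blast
qed

text \<open>
  Entries are related in multiplied form because both sides of this relation vanish on the diagonal,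
  where \<open>d i + d i\<close> may be zero and division would be unavailable.
\<close>

lemma angular_velocity_entry:
  fixes M :: "real^'n^'n"
  assumes "\<And>i j. i \<noteq> j \<Longrightarrow> d i + d j > 0" and "M \<in> so"
  shows "angular_velocity (diag_matrix d) M \<in> so"
    and "M $ i $ j = (d i + d j) * angular_velocity (diag_matrix d) M $ i $ j"
proof -
  let ?W = "angular_velocity (diag_matrix d) M"
  have W: "?W \<in> so \<and> M = ?W ** diag_matrix d + diag_matrix d ** ?W"
    unfolding angular_velocity_def by (rule theI'[OF angular_velocity_unique[OF assms]])
  then show "?W \<in> so"
    by blast
  show "M $ i $ j = (d i + d j) * ?W $ i $ j"
    using arg_cong[OF conjunct2[OF W], of "\<lambda>A. A $ i $ j"] unfolding momentum_entry .
qed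

lemma equilibrium_if_unique_nonzero_neighbour:
  fixes M :: "real^'n^'n"
  assumes pos: "\<And>i j. i \<noteq> j \<Longrightarrow> d i + d j > 0" and M: "M \<in> so"
    and unique: "\<And>i j k. M $ i $ j \<noteq> 0 \<Longrightarrow> M $ j $ k \<noteq> 0 \<Longrightarrow> i = k"
  shows "rigid_body_equilibrium (diag_matrix d) M"
proof -
  define W where "W = angular_velocity (diag_matrix d) M"
  have W: "W \<in> so" and MW: "M $ i $ j = (d i + d j) * W $ i $ j" for i j
    unfolding W_def using angular_velocity_entry[of d M, OF _ M] pos by blast+
  have skew: "A $ j $ i = - A $ i $ j" if "A \<in> so" for A :: "real^'n^'n" and i j
    using that unfolding so_entry by blast
  have support: "W $ i $ j = 0" if "M $ i $ j = 0" for i j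
  proof (cases "i = j")
    case True
    then show ?thesis
      using skew[OF W, of i i] by simp
  next
    case False
    then show ?thesis
      using that pos[of i j] by (simp add: MW)
  qed
  have "M $ i $ j * W $ j $ k = W $ i $ j * M $ j $ k" for i j k
  proof (cases "i = k")
    case True
    then show ?thesis
      using skew[OF M, of i j] skew[OF W, of i j] by simp
  next
    case False
    then have "M $ i $ j = 0 \<or> M $ j $ k = 0"
      using unique by blast
    then show ?thesis
      using support[of i j] support[of j k] by auto
  qed
  then have "lie_bracket M W = 0"
    by (simp add: lie_bracket_def vec_eq_iff matrix_matrix_mult_def)
  then show ?thesis
    using M by (simp add: rigid_body_equilibrium_def rigid_body_field_def W_def)
qed

theorem theorem2p1:
  fixes d :: "'n::{finite,linorder} \<Rightarrow> real"
    and h :: "(real^'n::{finite,linorder}^'n::{finite,linorder}) set"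
    and M :: "real^'n::{finite,linorder}^'n::{finite,linorder}"
  assumes "\<And>i j. i \<noteq> j \<Longrightarrow> d i + d j > 0"
    and "inj d"
    and "cartan_subalgebra h so"
    and "\<exists>B. B \<subseteq> {E i j | i j. i < j} \<and> independent B \<and> span B = h"
    and "M \<in> h"
  shows "rigid_body_equilibrium (diag_matrix d) M"
proof -
  have h: "lie_subalgebra h so" "lie_nilpotent h"
    using assms(3) by (simp_all add: cartan_subalgebra_def)
  obtain B where B: "B \<subseteq> {E i j | i j. i < j}" "span B = h"
    using assms(4) by blast
  show ?thesis
  proof (rule equilibrium_if_unique_nonzero_neighbour)
    show "d i + d j > 0" if "i \<noteq> j" for i j
      using that by (rule assms(1))
    show "M \<in> so"
      using h(1) assms(5) by (auto simp: lie_subalgebra_def)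
    show "i = k" if "M $ i $ j \<noteq> 0" "M $ j $ k \<noteq> 0" for i j k
      using that by (rule unique_nonzero_neighbour[OF h B assms(5)])
  qed
qed

end
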